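(* Let $(\alpha,\beta)$ be a random vector in $\mathbb{R}^2$ such that (i) $\mathbb{P}(\alpha\neq 0)=1$; (ii) $\mathbb{P}(|\alpha|\neq 1)>0$; (iii) for every $c\in\mathbb{R}$, $\mathbb{P}(\alpha(c-\beta)=c)<1$. Suppose that $q:=\mathbb{P}(\alpha<0)>0$, and let $y:\mathbb{R}\to\mathbb{R}$ be a bounded solution of $$y(x)=\mathbb{E}\{y(\alpha(x-\beta))\},\qquad x\in\mathbb{R}.$$ Then $$\liminf_{x\to-\infty}y(x)=\liminf_{x\to+\infty}y(x),\qquad \limsup_{x\to-\infty}y(x)=\limsup_{x\to+\infty}y(x).$$
   Context: A bounded solution means a bounded Borel measurable function $y:\mathbb{R}\to\mathbb{R}$ (continuity is not required) satisfying the equation for every $x\in\mathbb{R}$. Expectations $\mathbb{E}$ are taken with respect to the joint distribution of $(\alpha,\beta)$; $\alpha$ and $\beta$ need not be independent of each other. *)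

theory Defs
  imports "HOL-Probability.Probability"
begin

text \<open>
  The random vector is given by its two coordinates \<open>\<alpha>\<close> and \<open>\<beta>\<close> on a common probability
  space \<open>M\<close>; no independence is assumed.  When these are measurable, the integrand is bounded
  and measurable, so the Bochner integral below is the genuine expectation.
\<close>
definition bounded_solution ::
  "'a measure \<Rightarrow> ('a \<Rightarrow> real) \<Rightarrow> ('a \<Rightarrow> real) \<Rightarrow> (real \<Rightarrow> real) \<Rightarrow> bool" where
  "bounded_solution M \<alpha> \<beta> y \<longleftrightarrow>
     y \<in> borel_measurable borel \<and> bounded (range y) \<and>
     (\<forall>x. y x = (\<integral>\<omega>. y (\<alpha> \<omega> * (x - \<beta> \<omega>)) \<partial>M))"

end

theory Submission
  imports Defs
begin

text \<open>
  As x tends to plus infinity, the argument \<open>\<alpha> (x - \<beta>)\<close> tends to plus infinity on \<open>\<alpha> > 0\<close> and to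
  minus infinity on \<open>\<alpha> < 0\<close>.  With A and B the upper limits of y at minus and plus infinity, the
  reverse Fatou lemma applied to the equation gives \<open>B \<le> (1 - q) B + q A\<close>, so \<open>B \<le> A\<close> because
  \<open>q > 0\<close>.  The class of solutions is stable under reflecting x (with \<open>- \<beta>\<close> in place of \<open>\<beta>\<close>) and
  under negating y; these symmetries give the other three inequalities.
\<close>

lemma bounded_solutionD:
  assumes "bounded_solution M \<alpha> \<beta> y"
  shows "y \<in> borel_measurable borel" and "bounded (range y)"
    and "y x = (\<integral>\<omega>. y (\<alpha> \<omega> * (x - \<beta> \<omega>)) \<partial>M)"
  using assms unfolding bounded_solution_def by blast+

text \<open>Since \<alpha> (- x - \<beta>) = - (\<alpha> (x + \<beta>)), only the sign of
  \<open>\<beta>\<close> changes. As \<open>\<alpha>\<close> stays the same, conditions on its sign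
  carry over unchanged to the reflected solution.\<close>

lemma bounded_solution_reflect:
  assumes "bounded_solution M \<alpha> \<beta> y"
  shows "bounded_solution M \<alpha> (\<lambda>\<omega>. - \<beta> \<omega>) (\<lambda>x. y (- x))"
  unfolding bounded_solution_def
proof (intro conjI allI)
  note [measurable] = bounded_solutionD(1)[OF assms]
  show "(\<lambda>x. y (- x)) \<in> borel_measurable borel"
    by measurable
  show "bounded (range (\<lambda>x. y (- x)))"
    by (rule bounded_subset[OF bounded_solutionD(2)[OF assms]]) auto
  have "\<alpha> \<omega> * (- x - \<beta> \<omega>) = - (\<alpha> \<omega> * (x - - \<beta> \<omega>))" for \<omega> x
    by (simp add: algebra_simps)
  then show "y (- x) = (\<integral>\<omega>. y (- (\<alpha> \<omega> * (x - - \<beta> \<omega>))) \<partial>M)" for x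
    using bounded_solutionD(3)[OF assms, of "- x"] by (simp only:)
qed

lemma bounded_solution_uminus:
  assumes "bounded_solution M \<alpha> \<beta> y"
  shows "bounded_solution M \<alpha> \<beta> (\<lambda>x. - y x)"
  unfolding bounded_solution_def
proof (intro conjI allI)
  note [measurable] = bounded_solutionD(1)[OF assms]
  show "(\<lambda>x. - y x) \<in> borel_measurable borel"
    by measurable
  show "bounded (range (\<lambda>x. - y x))"
    using bounded_solutionD(2)[OF assms] by (simp add: bounded_iff)
  show "- y x = (\<integral>\<omega>. - y (\<alpha> \<omega> * (x - \<beta> \<omega>)) \<partial>M)" for x
    by (subst bounded_solutionD(3)[OF assms]) (rule integral_minus[symmetric])
qed

lemma Limsup_at_bot_reflect:
  fixes f :: "real \<Rightarrow> 'a::complete_linorder"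
  shows "Limsup at_bot f = Limsup at_top (\<lambda>x. f (- x))"
  by (simp add: at_bot_mirror Limsup_filtermap_eq)

text \<open>This brings the upper limits back from \<open>ereal\<close> to \<open>real\<close>,
  where \<open>B + p * (A - B)\<close> can be handled by ordinary arithmetic.\<close>

lemma Limsup_bounded_real:
  fixes f :: "'a \<Rightarrow> real"
  assumes "F \<noteq> bot" and "bounded (range f)"
  obtains l where "Limsup F (\<lambda>x. ereal (f x)) = ereal l"
proof -
  obtain K where K: "\<And>x. \<bar>f x\<bar> \<le> K"
    using assms(2) by (auto simp: bounded_iff)
  have "ereal (- K) \<le> Liminf F (\<lambda>x. ereal (f x))"
    by (intro Liminf_bounded always_eventually allI) (use K in \<open>simp add: abs_le_iff minus_le_iff\<close>)
  also have "\<dots> \<le> Limsup F (\<lambda>x. ereal (f x))"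
    by (rule Liminf_le_Limsup[OF assms(1)])
  finally have "ereal (- K) \<le> Limsup F (\<lambda>x. ereal (f x))" .
  moreover have "Limsup F (\<lambda>x. ereal (f x)) \<le> ereal K"
    by (intro Limsup_bounded always_eventually allI) (use K in \<open>simp add: abs_le_iff\<close>)
  ultimately show ?thesis
    using that by (cases "Limsup F (\<lambda>x. ereal (f x))") auto
qed

text \<open>This is the reverse Fatou step. The function \<open>y\<close> itself need not converge
  at either end, so it is replaced by a bounded majorant \<open>u\<close> that is constant near both
  ends. Dominated convergence then applies to \<open>u\<close> directly along the real filter
  \<open>at_top\<close>.\<close>

lemma (in prob_space) bounded_solution_Limsup_le_mean:
  fixes \<alpha> \<beta> :: "'a \<Rightarrow> real" and a b :: real
  assumes [measurable]: "\<alpha> \<in> borel_measurable M" "\<beta> \<in> borel_measurable M"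
    and nz: "AE \<omega> in M. \<alpha> \<omega> \<noteq> 0"
    and sol: "bounded_solution M \<alpha> \<beta> y"
    and a: "\<forall>\<^sub>F x in at_bot. y x \<le> a" and b: "\<forall>\<^sub>F x in at_top. y x \<le> b"
  shows "Limsup at_top (\<lambda>x. ereal (y x))
           \<le> ereal (b + \<P>(\<omega> in M. \<alpha> \<omega> < 0) * (a - b))"
proof -
  note [measurable] = bounded_solutionD(1)[OF sol]
  obtain K where K: "\<And>x. \<bar>y x\<bar> \<le> K"
    using bounded_solutionD(2)[OF sol] by (auto simp: bounded_iff)
  obtain S T where S: "\<And>x. x \<le> S \<Longrightarrow> y x \<le> a" and T: "\<And>x. x \<ge> T \<Longrightarrow> y x \<le> b"
    using a b by (auto simp: eventually_at_bot_linorder eventually_at_top_linorder)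
  \<comment> \<open>Between the two thresholds the global bound \<open>K\<close> serves as majorant.
    The \<open>S + 1\<close> keeps the first case away from \<open>t \<le> S\<close>, so that
    \<open>u\<close> equals \<open>a\<close> on that whole half-line.\<close>
  define u where "u t = (if t \<ge> max T (S + 1) then b else if t \<le> S then a else K)" for t
  have [measurable]: "u \<in> borel_measurable borel"
    unfolding u_def by measurable
  have yu: "y t \<le> u t" for t
    using S[of t] T[of t] K[of t] by (auto simp: u_def)
  have ub: "\<bar>u t\<bar> \<le> \<bar>a\<bar> + \<bar>b\<bar> + \<bar>K\<bar>" for t
    by (auto simp: u_def)
  have u_top: "\<forall>\<^sub>F t in at_top. u t = b"
    using eventually_ge_at_top[of "max T (S + 1)"] by eventually_elim (simp add: u_def)
  have u_bot: "\<forall>\<^sub>F t in at_bot. u t = a"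
    using eventually_le_at_bot[of S] by eventually_elim (simp add: u_def)
  \<comment> \<open>The pointwise limit is \<open>a\<close> where \<alpha> < 0 and \<open>b\<close>
    where \<alpha> > 0. In this affine form its integral is read off from the probability of
    \<alpha> < 0.\<close>
  define g where "g \<omega> = b + indicator {\<omega>\<in>space M. \<alpha> \<omega> < 0} \<omega> * (a - b)" for \<omega>
  have [measurable]: "g \<in> borel_measurable M"
    unfolding g_def by measurable
  have shift: "filterlim (\<lambda>x. x - c) at_top at_top" for c :: real
    using filterlim_tendsto_add_at_top[OF tendsto_const filterlim_ident, of "- c"]
    by simp
  have "((\<lambda>x. \<integral>\<omega>. u (\<alpha> \<omega> * (x - \<beta> \<omega>)) \<partial>M) \<longlongrightarrow> (\<integral>\<omega>. g \<omega> \<partial>M)) at_top"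
  proof (rule integral_dominated_convergence_at_top[where w = "\<lambda>_. \<bar>a\<bar> + \<bar>b\<bar> + \<bar>K\<bar>"])
    show "AE \<omega> in M. ((\<lambda>x. u (\<alpha> \<omega> * (x - \<beta> \<omega>))) \<longlongrightarrow> g \<omega>) at_top"
      using nz AE_space
    proof eventually_elim
      case (elim \<omega>)
      show ?case
      proof (cases "\<alpha> \<omega> < 0")
        case True
        have "filterlim (\<lambda>x. \<alpha> \<omega> * (x - \<beta> \<omega>)) at_bot at_top"
          by (rule filterlim_tendsto_neg_mult_at_bot[OF tendsto_const True shift])
        from filterlim_iff[THEN iffD1, OF this, rule_format, OF u_bot]
        show ?thesis
          using True elim by (intro tendsto_eventually) (simp add: g_def)
      next
        case False
        then have "0 < \<alpha> \<omega>"
          using elim by simp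
        then have "filterlim (\<lambda>x. \<alpha> \<omega> * (x - \<beta> \<omega>)) at_top at_top"
          by (rule filterlim_tendsto_pos_mult_at_top[OF tendsto_const _ shift])
        from filterlim_iff[THEN iffD1, OF this, rule_format, OF u_top]
        show ?thesis
          using False by (intro tendsto_eventually) (simp add: g_def)
      qed
    qed
  qed (use ub in auto)
  also have "(\<integral>\<omega>. g \<omega> \<partial>M) = b + \<P>(\<omega> in M. \<alpha> \<omega> < 0) * (a - b)"
    by (simp add: g_def prob_space less_top[symmetric])
  finally have "((\<lambda>x. ereal (\<integral>\<omega>. u (\<alpha> \<omega> * (x - \<beta> \<omega>)) \<partial>M))
      \<longlongrightarrow> ereal (b + \<P>(\<omega> in M. \<alpha> \<omega> < 0) * (a - b))) at_top"
    by simp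
  then have "Limsup at_top (\<lambda>x. ereal (\<integral>\<omega>. u (\<alpha> \<omega> * (x - \<beta> \<omega>)) \<partial>M))
      = ereal (b + \<P>(\<omega> in M. \<alpha> \<omega> < 0) * (a - b))"
    by (intro lim_imp_Limsup) auto
  \<comment> \<open>Here the equation enters: \<open>y x\<close> is the mean of \<open>y\<close>,
    which is at most the mean of \<open>u\<close>. Boundedness supplies the integrability of both
    sides that monotonicity of the integral requires.\<close>
  moreover have "y x \<le> (\<integral>\<omega>. u (\<alpha> \<omega> * (x - \<beta> \<omega>)) \<partial>M)" for x
  proof -
    have "integrable M (\<lambda>\<omega>. y (\<alpha> \<omega> * (x - \<beta> \<omega>)))"
      by (rule integrable_const_bound[where B = K]) (use K in auto)
    moreover have "integrable M (\<lambda>\<omega>. u (\<alpha> \<omega> * (x - \<beta> \<omega>)))"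
      by (rule integrable_const_bound[where B = "\<bar>a\<bar> + \<bar>b\<bar> + \<bar>K\<bar>"]) (use ub in auto)
    ultimately show ?thesis
      by (subst bounded_solutionD(3)[OF sol]) (intro integral_mono yu)
  qed
  then have "Limsup at_top (\<lambda>x. ereal (y x))
      \<le> Limsup at_top (\<lambda>x. ereal (\<integral>\<omega>. u (\<alpha> \<omega> * (x - \<beta> \<omega>)) \<partial>M))"
    by (intro Limsup_mono always_eventually) simp
  ultimately show ?thesis
    by simp
qed

lemma (in prob_space) bounded_solution_Limsup_le:
  fixes \<alpha> \<beta> :: "'a \<Rightarrow> real"
  assumes meas: "\<alpha> \<in> borel_measurable M" "\<beta> \<in> borel_measurable M"
    and nz: "AE \<omega> in M. \<alpha> \<omega> \<noteq> 0"
    and q: "\<P>(\<omega> in M. \<alpha> \<omega> < 0) > 0"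
    and sol: "bounded_solution M \<alpha> \<beta> y"
  shows "Limsup at_top (\<lambda>x. ereal (y x)) \<le> Limsup at_bot (\<lambda>x. ereal (y x))"
proof -
  define p where "p = \<P>(\<omega> in M. \<alpha> \<omega> < 0)"
  note bdd = bounded_solutionD(2)[OF sol]
  obtain A where A: "Limsup at_bot (\<lambda>x. ereal (y x)) = ereal A"
    using Limsup_bounded_real[OF _ bdd, of at_bot] by auto
  obtain B where B: "Limsup at_top (\<lambda>x. ereal (y x)) = ereal B"
    using Limsup_bounded_real[OF _ bdd, of at_top] by auto
  \<comment> \<open>Taking \<open>a = A + \<epsilon>\<close> and \<open>b = B + \<epsilon>\<close>
    leaves \<open>a - b\<close> unchanged, so the bound grows by exactly \<epsilon>.\<close>
  have "B \<le> (B + p * (A - B)) + \<epsilon>" if "\<epsilon> > 0" for \<epsilon>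
  proof -
    have "\<forall>\<^sub>F x in at_bot. ereal (y x) < ereal (A + \<epsilon>)"
      by (rule Limsup_lessD) (use A that in simp)
    then have a: "\<forall>\<^sub>F x in at_bot. y x \<le> A + \<epsilon>"
      by eventually_elim simp
    have "\<forall>\<^sub>F x in at_top. ereal (y x) < ereal (B + \<epsilon>)"
      by (rule Limsup_lessD) (use B that in simp)
    then have b: "\<forall>\<^sub>F x in at_top. y x \<le> B + \<epsilon>"
      by eventually_elim simp
    show ?thesis
      using bounded_solution_Limsup_le_mean[OF meas nz sol a b]
      by (simp add: B p_def)
  qed
  then have "B \<le> B + p * (A - B)"
    by (rule field_le_epsilon)
  \<comment> \<open>The previous line says 0 \<le> p (A - B), and p is positive.\<close>
  then have "B \<le> A"
    using q by (simp add: p_def zero_le_mult_iff)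
  then show ?thesis
    by (simp add: A B)
qed

lemma (in prob_space) bounded_solution_Limsup_eq:
  fixes \<alpha> \<beta> :: "'a \<Rightarrow> real"
  assumes meas: "\<alpha> \<in> borel_measurable M" "\<beta> \<in> borel_measurable M"
    and nz: "AE \<omega> in M. \<alpha> \<omega> \<noteq> 0"
    and q: "\<P>(\<omega> in M. \<alpha> \<omega> < 0) > 0"
    and sol: "bounded_solution M \<alpha> \<beta> y"
  shows "Limsup at_bot (\<lambda>x. ereal (y x)) = Limsup at_top (\<lambda>x. ereal (y x))"
proof (rule antisym)
  have "(\<lambda>\<omega>. - \<beta> \<omega>) \<in> borel_measurable M"
    using meas(2) by measurable
  from bounded_solution_Limsup_le[OF meas(1) this nz q bounded_solution_reflect[OF sol]]
  show "Limsup at_bot (\<lambda>x. ereal (y x)) \<le> Limsup at_top (\<lambda>x. ereal (y x))"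
    by (simp add: Limsup_at_bot_reflect)
qed (rule bounded_solution_Limsup_le[OF meas nz q sol])

theorem theorem4p2:
  fixes M :: "'a measure" and \<alpha> \<beta> :: "'a \<Rightarrow> real" and y :: "real \<Rightarrow> real"
  assumes "prob_space M"
    and "\<alpha> \<in> borel_measurable M" and "\<beta> \<in> borel_measurable M"
    and "\<P>(\<omega> in M. \<alpha> \<omega> \<noteq> 0) = 1"
    and "\<P>(\<omega> in M. \<bar>\<alpha> \<omega>\<bar> \<noteq> 1) > 0"
    and "\<And>c::real. \<P>(\<omega> in M. \<alpha> \<omega> * (c - \<beta> \<omega>) = c) < 1"
    and "\<P>(\<omega> in M. \<alpha> \<omega> < 0) > 0"
    and "bounded_solution M \<alpha> \<beta> y"
  shows "Liminf at_bot (\<lambda>x. ereal (y x)) = Liminf at_top (\<lambda>x. ereal (y x)) \<and>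
         Limsup at_bot (\<lambda>x. ereal (y x)) = Limsup at_top (\<lambda>x. ereal (y x))"
proof -
  interpret prob_space M by fact
  note [measurable] = assms(2)
  have nz: "AE \<omega> in M. \<alpha> \<omega> \<noteq> 0"
    using assms(4) by (subst (asm) prob_Collect_eq_1) auto
  note eq = bounded_solution_Limsup_eq[OF assms(2,3) nz assms(7)]
  show ?thesis
    \<comment> \<open>The upper limit of \<open>- y\<close> is minus the lower limit of
      \<open>y\<close>, so the second instance is the claim on lower limits. The flipped rule pulls
      the minus sign out of \<open>ereal\<close> so that \<open>ereal_Limsup_uminus\<close> can
      match.\<close>
    using eq[OF assms(8)] eq[OF bounded_solution_uminus[OF assms(8)]]
    by (simp add: ereal_Limsup_uminus flip: uminus_ereal.simps)
qed

end
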